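(* Let $\alpha\le1$ and $\lambda\in[0,1]$. Let $f\in\mathfrak{G}_\alpha^\lambda$ and let $g\in\mathcal{A}$ be such that $\operatorname{Re}\frac{g(z)}{z}>\frac12$ on $\mathbb{D}$. Then $f\in\mathcal{G}_0$ and $f*g\in\mathfrak{G}_\alpha^\lambda$.
   Context: Let $\mathbb{D}$ be the open unit disk. $\mathcal{A}$ is the set of holomorphic $f:\mathbb{D}\to\mathbb{C}$ with $f(0)=0$, $f'(0)=1$; quotients $f(z)/z$ are extended by their limit at $0$. $\mathcal{G}_0=\{f\in\mathcal{A}:\operatorname{Re}(f(z)/z)>0,\ z\in\mathbb{D}\}$. For $\alpha\le1$, $\lambda\in[0,1]$, $$\mathfrak{G}_\alpha^\lambda=\left\{f\in\mathcal{A}:\ \operatorname{Re}\left[\alpha\frac{f(z)}{z}+(1-\alpha)f'(z)\right]\ge1-\lambda,\ z\in\mathbb{D}\setminus\{0\}\right\}.$$ For $f(z)=\sum_{n\ge0}a_nz^n$ and $g(z)=\sum_{n\ge0}b_nz^n$ holomorphic on $\mathbb{D}$, $f*g(z)=\sum_{n\ge0}a_nb_nz^n$ is the Hadamard product. *)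

theory Defs
  imports "HOL-Complex_Analysis.Complex_Analysis"
begin

abbreviation unit_disk :: "complex set" where
  "unit_disk \<equiv> ball 0 1"

text \<open>Functions on the unit disk are total functions on the complex plane of which only the
  values on the unit disk matter.\<close>

definition class_A :: "(complex \<Rightarrow> complex) set" where
  "class_A = {f. f holomorphic_on unit_disk \<and> f 0 = 0 \<and> deriv f 0 = 1}"

definition quotient_id :: "(complex \<Rightarrow> complex) \<Rightarrow> complex \<Rightarrow> complex" where
  "quotient_id f z = (if z = 0 then Lim (at 0) (\<lambda>w. f w / w) else f z / z)"

definition class_G0 :: "(complex \<Rightarrow> complex) set" where
  "class_G0 = {f \<in> class_A. \<forall>z\<in>unit_disk. Re (quotient_id f z) > 0}"

definition class_G :: "real \<Rightarrow> real \<Rightarrow> (complex \<Rightarrow> complex) set" where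
  "class_G \<alpha> lam = {f \<in> class_A. \<forall>z\<in>unit_disk - {0}.
     Re (of_real \<alpha> * (f z / z) + (1 - of_real \<alpha>) * deriv f z) \<ge> 1 - lam}"

text \<open>The coefficients are those of the Taylor expansions at \<open>0\<close>; the series is meant for
  \<open>z\<close> in the unit disk.\<close>

definition hadamard_product ::
  "(complex \<Rightarrow> complex) \<Rightarrow> (complex \<Rightarrow> complex) \<Rightarrow> complex \<Rightarrow> complex" where
  "hadamard_product f g z =
     (\<Sum>n. fps_nth (fps_expansion f 0) n * fps_nth (fps_expansion g 0) n * z ^ n)"

end

theory Submission
  imports Defs
begin

text \<open>
  Write \<open>p z = f z / z\<close>. Then \<open>\<alpha> * f z / z + (1 - \<alpha>) * f' z = p z + (1 - \<alpha>) * z * p' z\<close>, and at a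
  minimum of \<open>Re p\<close> over a closed disk the radial derivative \<open>Re (z * p' z)\<close> is not positive; so a
  lower bound for the real part of this expression is one for \<open>Re p\<close>, and the maximum modulus
  principle applied to \<open>exp (- p)\<close> makes \<open>Re p > 0\<close> strict. For the Hadamard product, the
  expression for \<open>f * g\<close> is the Hadamard product of that for \<open>f\<close> with \<open>g z / z\<close>, which averages
  its rotations with the positive weight \<open>2 * Re (g z / z) - 1\<close> of mean \<open>1\<close>. The average
  is taken over roots of unity after truncating both series to polynomials.
\<close>

section \<open>Power series\<close>

text \<open>Splitting \<open>r ^ n\<close> as \<open>s ^ n * s ^ n\<close> with
  \<open>s = sqrt r < 1\<close> gives each series its own power of \<open>s\<close>. The terms of
  \<open>F\<close> at \<open>s\<close> are then bounded and those of \<open>G\<close> absolutely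
  summable, so the products are summable.\<close>

lemma fps_conv_radius_hadamard_ge_1:
  fixes F G :: "complex fps"
  assumes "fps_conv_radius F \<ge> 1" and "fps_conv_radius G \<ge> 1"
  shows "fps_conv_radius (Abs_fps (\<lambda>n. fps_nth F n * fps_nth G n)) \<ge> 1"
  unfolding fps_conv_radius_def
proof (rule conv_radius_geI_ex)
  fix r :: real assume r: "0 < r" "ereal r < 1"
  define s where "s = sqrt r"
  have s: "0 < s" "s < 1" "s * s = r"
    using r by (auto simp: s_def)
  have lt: "ereal (norm (complex_of_real s)) < fps_conv_radius F"
    "ereal (norm (complex_of_real s)) < fps_conv_radius G"
    using s by (auto intro: less_le_trans[OF _ assms(1)] less_le_trans[OF _ assms(2)])
  have "(\<lambda>n. fps_nth F n * of_real s ^ n) \<longlonglongrightarrow> 0"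
    by (intro summable_LIMSEQ_zero summable_fps lt)
  then have "Bseq (\<lambda>n. fps_nth F n * of_real s ^ n)"
    by (intro convergent_imp_Bseq convergentI)
  then obtain K where K: "\<And>n. norm (fps_nth F n * of_real s ^ n) \<le> K"
    by (elim BseqE) blast
  have "summable (\<lambda>n. (fps_nth F n * fps_nth G n) * of_real r ^ n)"
  proof (rule summable_comparison_test')
    show "summable (\<lambda>n. K * norm (fps_nth G n * of_real s ^ n))"
      by (intro summable_mult norm_summable_fps lt)
    fix n :: nat
    have "(fps_nth F n * fps_nth G n) * of_real r ^ n
        = (fps_nth F n * of_real s ^ n) * (fps_nth G n * of_real s ^ n)"
      by (simp add: s(3)[symmetric] power_mult_distrib)
    then show "norm ((fps_nth F n * fps_nth G n) * of_real r ^ n)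
        \<le> K * norm (fps_nth G n * of_real s ^ n)"
      using K[of n] by (simp only: norm_mult[of "fps_nth F n * of_real s ^ n"] mult_right_mono norm_ge_zero)
  qed
  then show "\<exists>z. norm z = r \<and> summable (\<lambda>n. fps_nth (Abs_fps (\<lambda>n. fps_nth F n * fps_nth G n)) n * z ^ n)"
    using r by (intro exI[of _ "of_real r"]) auto
qed

text \<open>Uniformity lets one truncation degree serve all points of a circle at once when bounds
  on real parts are passed to polynomials.\<close>

lemma uniform_limit_fps_partial_sums:
  fixes F :: "complex fps"
  assumes "ereal r < fps_conv_radius F"
  shows "uniform_limit (cball 0 r) (\<lambda>n z. \<Sum>i<n. fps_nth F i * z ^ i) (eval_fps F) sequentially"
  using powser_uniform_limit[of r "fps_nth F" 0] assms
  by (simp add: fps_conv_radius_def eval_fps_def[abs_def])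

section \<open>Averages over roots of unity\<close>

text \<open>For \<open>0 < j < N\<close> this is a geometric sum in \<open>k\<close> whose ratio is
  an \<open>N\<close>-th root of unity, different from 1 because \<open>N\<close> does not divide
  \<open>j\<close>.\<close>

lemma sum_power_root_of_unity:
  assumes "j < N"
  shows "(\<Sum>k<N. (cis (2 * pi / real N) ^ k) ^ j) = (if j = 0 then of_nat N else 0)"
proof (cases "j = 0")
  case False
  let ?w = "cis (2 * pi * real j / real N)"
  have "?w = exp (2 * of_real pi * \<i> * of_nat j / of_nat N)"
    by (simp add: cis_conv_exp mult_ac)
  moreover have "\<not> N dvd j"
    using False assms by (auto dest: dvd_imp_le)
  ultimately have "?w \<noteq> 1"
    using assms by (simp add: complex_root_unity_eq_1)
  moreover have "?w ^ N = 1"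
  proof -
    have "?w ^ N = cis (real N * (2 * pi * real j / real N))"
      by (rule Complex.DeMoivre)
    also have "\<dots> = cis (2 * pi * real j)"
      using assms by simp
    also have "\<dots> = 1"
      using cis_multiple_2pi[of "real j"] by simp
    finally show ?thesis .
  qed
  moreover have "(\<Sum>k<N. (cis (2 * pi / real N) ^ k) ^ j) = (\<Sum>k<N. ?w ^ k)"
    by (intro sum.cong refl) (simp add: Complex.DeMoivre mult_ac)
  ultimately show ?thesis
    using False by (simp add: geometric_sum)
qed auto

text \<open>Discrete orthogonality of characters. Since \<open>cnj (u k)\<close> is the inverse of
  \<open>u k\<close>, the smaller exponent cancels, and what remains is the preceding sum or its
  conjugate.\<close>

lemma sum_cnj_power_root_of_unity:
  assumes "n < N" "j < N"
  defines "u \<equiv> \<lambda>k. cis (2 * pi / real N) ^ k"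
  shows "(\<Sum>k<N. cnj (u k) ^ n * u k ^ j) = (if n = j then of_nat N else 0)"
proof -
  have unit: "cnj (u k) * u k = 1" for k
    by (simp add: u_def cis_cnj mult.commute[of "cnj _"] complex_norm_square[symmetric] norm_power del: complex_cnj_power)
  show ?thesis
  proof (cases "n \<le> j")
    case True
    have "cnj (u k) ^ n * u k ^ j = u k ^ (j - n)" for k
    proof -
      have "u k ^ j = u k ^ n * u k ^ (j - n)"
        using True by (simp flip: power_add)
      then show ?thesis
        by (simp add: mult.assoc[symmetric] power_mult_distrib[symmetric] unit del: complex_cnj_power)
    qed
    then show ?thesis
      using sum_power_root_of_unity[of "j - n" N] True assms by (auto simp: u_def)
  next
    case False
    have "cnj (u k) ^ n * u k ^ j = cnj (u k ^ (n - j))" for k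
    proof -
      have "cnj (u k) ^ n = cnj (u k) ^ (n - j) * cnj (u k) ^ j"
        using False by (simp flip: power_add del: complex_cnj_power)
      then show ?thesis
        by (simp add: mult.assoc power_mult_distrib[symmetric] unit)
    qed
    then have "(\<Sum>k<N. cnj (u k) ^ n * u k ^ j) = cnj (\<Sum>k<N. u k ^ (n - j))"
      by simp
    then show ?thesis
      using sum_power_root_of_unity[of "n - j" N] False assms by (auto simp: u_def)
  qed
qed

text \<open>With \<open>C\<close> and \<open>D\<close> the polynomials with coefficients
  \<open>c\<close> and \<open>d\<close>, the sum of the \<open>c n * d n\<close> is the mean of
  \<open>C (cnj u) * (2 * Re (D u) - 1)\<close> over suitable roots of unity \<open>u\<close>. The
  bound on \<open>d\<close> makes these weights nonnegative and \<open>d 0 = 1\<close> gives them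
  mean 1, so a lower bound for \<open>Re C\<close> on the circle survives.\<close>

lemma Re_sum_mult_ge:
  fixes c d :: "nat \<Rightarrow> complex"
  assumes d0: "d 0 = 1"
    and c: "\<And>u. norm u = 1 \<Longrightarrow> m \<le> Re (\<Sum>n<M. c n * u ^ n)"
    and d: "\<And>u. norm u = 1 \<Longrightarrow> 1 / 2 \<le> Re (\<Sum>n<M. d n * u ^ n)"
  shows "m \<le> Re (\<Sum>n<M. c n * d n)"
proof -
  \<comment> \<open>An empty sum would violate the bound 1/2 for \<open>d\<close>.\<close>
  have M: "M > 0"
    using d[of 1] by (cases M) auto
  \<comment> \<open>Products of two powers below \<open>M\<close> have degree at most
    \<open>2 * M - 2 < N\<close>, so in \<open>orth'\<close> no exponent other than 0 is a multiple
    of \<open>N\<close>.\<close>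
  define N where "N = 2 * M"
  define u where "u k = cis (2 * pi / real N) ^ k" for k :: nat
  define C where "C z = (\<Sum>n<M. c n * z ^ n)" for z
  define D where "D z = (\<Sum>n<M. d n * z ^ n)" for z
  have norm_u: "norm (u k) = 1" for k
    by (simp add: u_def norm_power)
  have orth: "(\<Sum>k<N. cnj (u k) ^ n * u k ^ j) = (if n = j then of_nat N else 0)"
    if "n < M" "j < M" for n j
    using sum_cnj_power_root_of_unity[of n N j] that by (simp add: N_def u_def)
  have orth': "(\<Sum>k<N. cnj (u k) ^ n * cnj (u k) ^ j) = (if n + j = 0 then of_nat N else 0)"
    if "n < M" "j < M" for n j
    using arg_cong[OF sum_power_root_of_unity[of "n + j" N], of cnj] that
    by (simp add: N_def u_def power_add split: if_splits)
  have CD: "(\<Sum>k<N. C (cnj (u k)) * D (u k)) = of_nat N * (\<Sum>n<M. c n * d n)"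
  proof -
    have "(\<Sum>k<N. C (cnj (u k)) * D (u k))
        = (\<Sum>k<N. \<Sum>n<M. \<Sum>j<M. c n * d j * (cnj (u k) ^ n * u k ^ j))"
      unfolding C_def D_def sum_product by (intro sum.cong refl) (simp add: mult_ac)
    also have "\<dots> = (\<Sum>n<M. \<Sum>k<N. \<Sum>j<M. c n * d j * (cnj (u k) ^ n * u k ^ j))"
      by (rule sum.swap)
    also have "\<dots> = (\<Sum>n<M. \<Sum>j<M. \<Sum>k<N. c n * d j * (cnj (u k) ^ n * u k ^ j))"
      by (intro sum.cong refl sum.swap)
    also have "\<dots> = (\<Sum>n<M. \<Sum>j<M. if n = j then c n * d j * of_nat N else 0)"
      unfolding sum_distrib_left[symmetric] by (intro sum.cong refl) (simp add: orth)
    also have "\<dots> = of_nat N * (\<Sum>n<M. c n * d n)"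
      by (simp add: sum.delta sum_distrib_left mult_ac)
    finally show ?thesis .
  qed
  \<comment> \<open>Both factors are polynomials in \<open>cnj (u k)\<close>, so only the product of
    the constant terms \<open>c 0\<close> and \<open>cnj (d 0) = 1\<close> survives.\<close>
  have CcnjD: "(\<Sum>k<N. C (cnj (u k)) * cnj (D (u k))) = of_nat N * c 0"
  proof -
    have "(\<Sum>k<N. C (cnj (u k)) * cnj (D (u k)))
        = (\<Sum>k<N. \<Sum>n<M. \<Sum>j<M. c n * cnj (d j) * (cnj (u k) ^ n * cnj (u k) ^ j))"
      unfolding C_def D_def cnj_sum sum_product by (intro sum.cong refl) (simp add: mult_ac)
    also have "\<dots> = (\<Sum>n<M. \<Sum>k<N. \<Sum>j<M. c n * cnj (d j) * (cnj (u k) ^ n * cnj (u k) ^ j))"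
      by (rule sum.swap)
    also have "\<dots> = (\<Sum>n<M. \<Sum>j<M. \<Sum>k<N. c n * cnj (d j) * (cnj (u k) ^ n * cnj (u k) ^ j))"
      by (intro sum.cong refl sum.swap)
    also have "\<dots> = (\<Sum>n<M. \<Sum>j<M. if j = 0 then (if n = 0 then c 0 * of_nat N else 0) else 0)"
      unfolding sum_distrib_left[symmetric] by (intro sum.cong refl) (auto simp: orth' d0)
    also have "\<dots> = of_nat N * c 0"
      using M by (simp add: sum.delta mult_ac)
    finally show ?thesis .
  qed
  have C1: "(\<Sum>k<N. C (cnj (u k))) = of_nat N * c 0"
  proof -
    have "(\<Sum>k<N. C (cnj (u k))) = (\<Sum>n<M. \<Sum>k<N. c n * (cnj (u k) ^ n * cnj (u k) ^ 0))"
      unfolding C_def by (subst sum.swap) simp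
    also have "\<dots> = (\<Sum>n<M. if n = 0 then c 0 * of_nat N else 0)"
      unfolding sum_distrib_left[symmetric] using M by (intro sum.cong refl) (subst orth', auto)
    also have "\<dots> = of_nat N * c 0"
      using M by (simp add: sum.delta mult_ac)
    finally show ?thesis .
  qed
  have D1: "(\<Sum>k<N. D (u k)) = of_nat N"
  proof -
    have "(\<Sum>k<N. D (u k)) = (\<Sum>n<M. \<Sum>k<N. d n * (cnj (u k) ^ 0 * u k ^ n))"
      unfolding D_def by (subst sum.swap) simp
    also have "\<dots> = (\<Sum>n<M. if n = 0 then of_nat N else 0)"
      unfolding sum_distrib_left[symmetric] using M by (intro sum.cong refl) (subst orth, auto simp: d0)
    also have "\<dots> = of_nat N"
      using M by (simp add: sum.delta)
    finally show ?thesis .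
  qed
  define w where "w k = 2 * Re (D (u k)) - 1" for k
  have w: "w k \<ge> 0" for k
    using d[OF norm_u[of k]] by (simp add: w_def D_def)
  \<comment> \<open>In this form the weighted sum splits into \<open>CD\<close>,
    \<open>CcnjD\<close> and \<open>C1\<close>; the last two cancel.\<close>
  have wc: "of_real (w k) = D (u k) + cnj (D (u k)) - 1" for k
    by (simp add: w_def complex_add_cnj)
  have "(\<Sum>k<N. C (cnj (u k)) * of_real (w k)) = of_nat N * (\<Sum>n<M. c n * d n)"
    using CD CcnjD C1 by (simp add: wc algebra_simps sum.distrib sum_subtractf)
  then have avg: "(\<Sum>k<N. Re (C (cnj (u k))) * w k) = real N * Re (\<Sum>n<M. c n * d n)"
    by (metis (no_types, lifting) Re_complex_of_real Re_sum complex_Re_of_nat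
        of_real_of_nat_eq scaleR_complex.sel(1) scaleR_conv_of_real mult.commute sum.cong)
  have "Re (\<Sum>k<N. D (u k)) = real N"
    by (simp add: D1)
  then have "(\<Sum>k<N. w k) = real N"
    by (simp add: w_def sum_subtractf sum_distrib_left[symmetric])
  then have "real N * m = (\<Sum>k<N. m * w k)"
    by (simp add: sum_distrib_left[symmetric])
  also have "\<dots> \<le> (\<Sum>k<N. Re (C (cnj (u k))) * w k)"
    using c norm_u by (intro sum_mono mult_right_mono w) (simp add: C_def)
  finally have "real N * m \<le> real N * Re (\<Sum>n<M. c n * d n)"
    by (simp add: avg)
  then show ?thesis
    using M by (simp add: N_def)
qed

text \<open>Writing \<open>z = v * of_real \<rho>\<close> with both factors inside the disk, the
  powers of \<open>v\<close> go to \<open>Q\<close> and those of \<open>\<rho>\<close> to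
  \<open>G\<close>. On the unit circle \<open>Q (v * u)\<close> and \<open>G (\<rho> * u)\<close>
  are then uniform limits of polynomials in \<open>u\<close>, to which \<open>Re_sum_mult_ge\<close>
  applies.\<close>

lemma Re_hadamard_ge:
  fixes Q G :: "complex fps"
  assumes Q: "fps_conv_radius Q \<ge> 1" and G: "fps_conv_radius G \<ge> 1" and G0: "fps_nth G 0 = 1"
    and ReQ: "\<And>z. norm z < 1 \<Longrightarrow> m \<le> Re (eval_fps Q z)"
    and ReG: "\<And>z. norm z < 1 \<Longrightarrow> 1 / 2 < Re (eval_fps G z)"
    and z: "norm z < 1"
  shows "m \<le> Re (eval_fps (Abs_fps (\<lambda>n. fps_nth Q n * fps_nth G n)) z)" (is "_ \<le> Re (eval_fps ?H z)")
proof -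
  \<comment> \<open>Any radius strictly between \<open>norm z\<close> and 1 would do; the midpoint
    is taken.\<close>
  define \<rho> where "\<rho> = (1 + norm z) / 2"
  have \<rho>: "0 < \<rho>" "\<rho> < 1" "norm z < \<rho>"
    using z norm_ge_zero[of z] by (auto simp: \<rho>_def simp del: norm_ge_zero)
  define v where "v = z / of_real \<rho>"
  have v: "norm v < 1" "z = v * of_real \<rho>"
    using \<rho> by (auto simp: v_def norm_divide)
  have rad: "ereal r < fps_conv_radius F" if "r < 1" "fps_conv_radius F \<ge> 1" for r and F :: "complex fps"
    using that by (auto intro: less_le_trans[OF _ that(2)])
  have Hrad: "fps_conv_radius ?H \<ge> 1"
    by (intro fps_conv_radius_hadamard_ge_1 Q G)
  have cont: "continuous_on (cball 0 \<rho>) (\<lambda>x. Re (eval_fps G x))"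
    by (intro continuous_intros) (use rad[OF _ G] \<rho> in auto)
  obtain x0 where x0: "x0 \<in> cball 0 \<rho>" "\<And>x. x \<in> cball 0 \<rho> \<Longrightarrow> Re (eval_fps G x0) \<le> Re (eval_fps G x)"
    using continuous_attains_inf[OF compact_cball _ cont] \<rho> by auto
  \<comment> \<open>The truncations of \<open>G\<close> must satisfy the bound 1/2 exactly to keep
    the weights nonnegative. By compactness the strict inequality leaves a uniform margin that
    absorbs the truncation error.\<close>
  define \<delta> where "\<delta> = Re (eval_fps G x0) - 1 / 2"
  have \<delta>: "\<delta> > 0"
    using ReG[of x0] x0 \<rho> by (simp add: \<delta>_def)
  \<comment> \<open>The truncation error of \<open>Q\<close> has no such margin: it costs
    \<open>e\<close>, which is arbitrary.\<close>
  have approx: "m - e \<le> Re (eval_fps ?H z)" if e: "e > 0" for e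
  proof (rule tendsto_lowerbound)
    have "summable (\<lambda>n. fps_nth ?H n * z ^ n)"
      by (intro summable_fps rad[OF z Hrad])
    then have "(\<lambda>M. \<Sum>n<M. fps_nth ?H n * z ^ n) \<longlonglongrightarrow> eval_fps ?H z"
      unfolding eval_fps_def by (rule summable_LIMSEQ)
    then show "(\<lambda>M. Re (\<Sum>n<M. fps_nth ?H n * z ^ n)) \<longlonglongrightarrow> Re (eval_fps ?H z)"
      by (rule tendsto_Re)
    have "\<forall>\<^sub>F M in sequentially. \<forall>x\<in>cball 0 (norm v). dist (\<Sum>i<M. fps_nth Q i * x ^ i) (eval_fps Q x) < e"
      by (intro uniform_limitD[OF uniform_limit_fps_partial_sums] rad Q v e)
    moreover have "\<forall>\<^sub>F M in sequentially. \<forall>x\<in>cball 0 \<rho>. dist (\<Sum>i<M. fps_nth G i * x ^ i) (eval_fps G x) < \<delta>"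
      by (intro uniform_limitD[OF uniform_limit_fps_partial_sums] rad G \<rho> \<delta>)
    ultimately show "\<forall>\<^sub>F M in sequentially. m - e \<le> Re (\<Sum>n<M. fps_nth ?H n * z ^ n)"
    proof eventually_elim
      case (elim M)
      have "m - e \<le> Re (\<Sum>n<M. (fps_nth Q n * v ^ n) * (fps_nth G n * of_real \<rho> ^ n))"
      proof (rule Re_sum_mult_ge)
        show "fps_nth G 0 * of_real \<rho> ^ 0 = 1"
          by (simp add: G0)
        fix u :: complex assume u: "norm u = 1"
        have "\<bar>Re (\<Sum>i<M. fps_nth Q i * (v * u) ^ i) - Re (eval_fps Q (v * u))\<bar> < e"
          using elim(1)[rule_format, of "v * u"] u abs_Re_le_cmod[of "(\<Sum>i<M. fps_nth Q i * (v * u) ^ i) - eval_fps Q (v * u)"]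
          by (simp add: dist_norm norm_mult)
        moreover have "m \<le> Re (eval_fps Q (v * u))"
          using v u by (intro ReQ) (simp add: norm_mult)
        ultimately show "m - e \<le> Re (\<Sum>n<M. fps_nth Q n * v ^ n * u ^ n)"
          by (simp add: power_mult_distrib mult.assoc)
        have "\<bar>Re (\<Sum>i<M. fps_nth G i * (of_real \<rho> * u) ^ i) - Re (eval_fps G (of_real \<rho> * u))\<bar> < \<delta>"
          using elim(2)[rule_format, of "of_real \<rho> * u"] u \<rho> abs_Re_le_cmod[of "(\<Sum>i<M. fps_nth G i * (of_real \<rho> * u) ^ i) - eval_fps G (of_real \<rho> * u)"]
          by (simp add: dist_norm norm_mult)
        moreover have "1 / 2 + \<delta> \<le> Re (eval_fps G (of_real \<rho> * u))"
          using x0(2)[of "of_real \<rho> * u"] u \<rho> by (simp add: \<delta>_def norm_mult)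
        ultimately show "1 / 2 \<le> Re (\<Sum>n<M. fps_nth G n * of_real \<rho> ^ n * u ^ n)"
          by (simp add: power_mult_distrib mult.assoc)
      qed
      also have "(\<Sum>n<M. (fps_nth Q n * v ^ n) * (fps_nth G n * of_real \<rho> ^ n)) = (\<Sum>n<M. fps_nth ?H n * z ^ n)"
        by (intro sum.cong refl) (simp add: v(2) power_mult_distrib)
      finally show ?case .
    qed
  qed simp
  show ?thesis
    by (rule field_le_epsilon) (use approx in \<open>simp add: algebra_simps\<close>)
qed

section \<open>Lower bounds for the real part\<close>

text \<open>At a minimum point \<open>x\<close> of \<open>Re p\<close> on the closed disk through
  \<open>z\<close>, the derivative term contributes at most 0, so the hypothesis at \<open>x\<close>
  already bounds \<open>Re (p x)\<close>. Only points of the segment from 0 to \<open>x\<close> are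
  compared with \<open>x\<close>, so it makes no difference whether \<open>x\<close> is on the
  boundary or inside.\<close>

lemma Re_ge_of_Re_add_deriv_ge:
  fixes p :: "complex \<Rightarrow> complex"
  assumes p: "\<And>z. z \<in> ball 0 R \<Longrightarrow> (p has_field_derivative p' z) (at z)"
    and "\<beta> \<ge> 0"
    and ge: "\<And>z. z \<in> ball 0 R \<Longrightarrow> m \<le> Re (p z + of_real \<beta> * (z * p' z))"
    and z: "z \<in> ball 0 R"
  shows "m \<le> Re (p z)"
proof -
  have sub: "cball 0 (norm z) \<subseteq> ball 0 R"
    using z by auto
  have "isCont p x" if "x \<in> cball 0 (norm z)" for x
    using p sub that by (blast intro: DERIV_isCont)
  then have "continuous_on (cball 0 (norm z)) p"
    by (intro continuous_at_imp_continuous_on ballI)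
  then have cont: "continuous_on (cball 0 (norm z)) (\<lambda>x. Re (p x))"
    by (intro continuous_intros)
  obtain x where x: "x \<in> cball 0 (norm z)" "\<And>y. y \<in> cball 0 (norm z) \<Longrightarrow> Re (p x) \<le> Re (p y)"
    using continuous_attains_inf[OF compact_cball _ cont] by auto
  have xR: "x \<in> ball 0 R"
    using x(1) sub by blast
  \<comment> \<open>The radial derivative at \<open>x\<close> is the derivative at
    \<open>t = 1\<close> of \<open>p\<close> along the ray \<open>x * t\<close>.\<close>
  have "((\<lambda>a. p (x * a)) has_field_derivative p' x * x) (at (of_real 1))"
    by (rule DERIV_chain2[of p]) (use p[OF xR] in \<open>auto intro!: derivative_eq_intros\<close>)
  then have "((\<lambda>t. p (x * of_real t)) has_vector_derivative p' x * x) (at 1)"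
    by (rule has_vector_derivative_real_field)
  then have "((\<lambda>t. p (x * of_real t)) has_vector_derivative x * p' x) (at 1)"
    by (simp add: mult.commute)
  then have der: "((\<lambda>t. Re (p (x * of_real t))) has_real_derivative Re (x * p' x)) (at 1)"
    by (simp only: has_field_derivative_Re)
  have "Re (x * p' x) \<le> 0"
  proof (rule ccontr)
    assume "\<not> Re (x * p' x) \<le> 0"
    then obtain d where d: "d > 0" "\<And>h. 0 < h \<Longrightarrow> h < d \<Longrightarrow> Re (p (x * of_real (1 - h))) < Re (p (x * of_real 1))"
      using DERIV_pos_inc_left[OF der] by auto
    \<comment> \<open>The cap at 1 keeps \<open>1 - h\<close> in \<open>[0, 1]\<close>, so the
      comparison point stays in the closed disk.\<close>
    define h where "h = min (d / 2) 1"
    have h: "0 < h" "h < d" "h \<le> 1"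
      using d(1) by (auto simp: h_def min_def)
    have "norm (x * of_real (1 - h)) \<le> norm x"
      using h by (simp only: norm_mult norm_of_real) (intro mult_right_le_one_le; simp)
    then have "Re (p x) \<le> Re (p (x * of_real (1 - h)))"
      using x(1) by (intro x(2)) simp
    then show False
      using d(2)[OF h(1,2)] by simp
  qed
  then have "\<beta> * Re (x * p' x) \<le> 0"
    using \<open>\<beta> \<ge> 0\<close> by (rule mult_nonneg_nonpos[rotated])
  then have "m \<le> Re (p x)"
    using ge[OF xR] by simp
  also have "\<dots> \<le> Re (p z)"
    by (intro x(2)) simp
  finally show ?thesis .
qed

text \<open>Since \<open>norm (exp (- p w)) = exp (- Re (p w)) \<le> 1\<close>, a zero of
  \<open>Re p\<close> would be an interior maximum. Then \<open>exp (- p)\<close> would be constant,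
  against its modulus being below 1 at \<open>a\<close>.\<close>

lemma Re_pos_of_Re_nonneg:
  assumes p: "p holomorphic_on S" and S: "open S" "connected S"
    and nonneg: "\<And>z. z \<in> S \<Longrightarrow> 0 \<le> Re (p z)"
    and a: "a \<in> S" "0 < Re (p a)" and z: "z \<in> S"
  shows "0 < Re (p z)"
proof (rule ccontr)
  assume "\<not> 0 < Re (p z)"
  then have "Re (p z) = 0"
    using nonneg[OF z] by simp
  have "(\<lambda>w. exp (- p w)) constant_on S"
    using \<open>Re (p z) = 0\<close> nonneg
    by (intro maximum_modulus_principle[OF _ S S(1) subset_refl z] holomorphic_intros p) simp
  then have "exp (- p a) = exp (- p z)"
    using a(1) z by (auto simp: constant_on_def)
  then have "norm (exp (- p a)) = norm (exp (- p z))"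
    by simp
  then show False
    using a(2) \<open>Re (p z) = 0\<close> by simp
qed

section \<open>The classes in terms of power series\<close>

lemma class_A_fps:
  assumes "f \<in> class_A"
  defines "F \<equiv> fps_expansion f 0"
  shows "fps_conv_radius F \<ge> 1" "fps_nth F 0 = 0" "fps_nth F (Suc 0) = 1"
    and "\<And>z. norm z < 1 \<Longrightarrow> f z = eval_fps F z"
proof -
  have holo: "f holomorphic_on eball 0 1"
    using assms(1) by (simp add: class_A_def one_ereal_def)
  show "fps_conv_radius F \<ge> 1"
    unfolding F_def by (rule conv_radius_fps_expansion[OF holo])
  show "f z = eval_fps F z" if "norm z < 1" for z
    using eval_fps_expansion'[OF holo, of z] that by (simp add: F_def)
  show "fps_nth F 0 = 0" "fps_nth F (Suc 0) = 1"
    using assms(1) by (simp_all add: F_def fps_expansion_def class_A_def)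
qed

lemma eval_fps_in_class_A:
  fixes F :: "complex fps"
  assumes "fps_conv_radius F \<ge> 1" "fps_nth F 0 = 0" "fps_nth F (Suc 0) = 1"
  shows "eval_fps F \<in> class_A"
proof -
  have "ereal (norm z) < fps_conv_radius F" if "norm z < 1" for z :: complex
    by (rule less_le_trans[OF _ assms(1)]) (use that in simp)
  then have "unit_disk \<subseteq> eball 0 (fps_conv_radius F)"
    by auto
  moreover have "norm (0::complex) < fps_conv_radius F"
    by (auto intro: less_le_trans[OF _ assms(1)])
  then have "deriv (eval_fps F) 0 = 1"
    using has_field_derivative_eval_fps[of 0 F UNIV] assms(3)
    by (simp add: DERIV_imp_deriv eval_fps_at_0)
  ultimately show ?thesis
    using assms(2) by (auto simp: class_A_def eval_fps_at_0 intro!: holomorphic_on_eval_fps)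
qed

lemma eval_fps_eq_mult_shift:
  fixes F :: "complex fps"
  assumes "norm z < fps_conv_radius F" "fps_nth F 0 = 0"
  shows "eval_fps F z = z * eval_fps (fps_shift 1 F) z"
proof -
  have "F = fps_X * fps_shift 1 F"
    by (rule fps_ext) (auto simp: assms(2) fps_X_mult_nth)
  then have "eval_fps F z = eval_fps (fps_X * fps_shift 1 F) z"
    by simp
  also have "\<dots> = z * eval_fps (fps_shift 1 F) z"
    using assms(1) by (subst eval_fps_mult) auto
  finally show ?thesis .
qed

text \<open>Away from 0 this is division of the series by \<open>z\<close>; at 0 the limit in the
  definition is found from the continuity of the shifted series.\<close>

lemma quotient_id_eq_eval_fps:
  assumes "f \<in> class_A" "norm z < 1"
  shows "quotient_id f z = eval_fps (fps_shift 1 (fps_expansion f 0)) z"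
proof -
  let ?F = "fps_expansion f 0"
  note F = class_A_fps[OF assms(1)]
  have rad: "norm w < fps_conv_radius ?F" if "norm w < 1" for w :: complex
    using that by (auto intro: less_le_trans[OF _ F(1)])
  have eq: "f w / w = eval_fps (fps_shift 1 ?F) w" if "norm w < 1" "w \<noteq> 0" for w
    using eval_fps_eq_mult_shift[OF rad F(2), of w] F(4)[of w] that by simp
  show ?thesis
  proof (cases "z = 0")
    case True
    have "(\<lambda>w. f w / w) \<midarrow>0\<rightarrow> eval_fps (fps_shift 1 ?F) 0"
    proof (rule Lim_transform_within_open[of _ _ 0 UNIV unit_disk])
      have "isCont (eval_fps (fps_shift 1 ?F)) 0"
        using rad[of 0] by (intro continuous_eval_fps) simp
      then show "eval_fps (fps_shift 1 ?F) \<midarrow>0\<rightarrow> eval_fps (fps_shift 1 ?F) 0"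
        by (simp add: isCont_def)
    qed (auto simp: eq)
    then show ?thesis
      using True by (simp add: quotient_id_def tendsto_Lim)
  qed (use assms eq in \<open>simp add: quotient_id_def\<close>)
qed

text \<open>From \<open>f z = z * P z\<close> follows \<open>deriv f z = P z + z * P' z\<close>, and
  the coefficients of \<open>P z\<close> add up to 1. The series \<open>F\<close> is left arbitrary
  so that the identity serves both \<open>f\<close> and the Hadamard product.\<close>

lemma class_G_expression_eq:
  fixes f :: "complex \<Rightarrow> complex" and F :: "complex fps"
  assumes f: "\<And>z. norm z < 1 \<Longrightarrow> f z = eval_fps F z"
    and F: "fps_conv_radius F \<ge> 1" "fps_nth F 0 = 0" and z: "norm z < 1" "z \<noteq> 0"
  defines "P \<equiv> fps_shift 1 F"
  shows "of_real \<alpha> * (f z / z) + (1 - of_real \<alpha>) * deriv f z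
       = eval_fps P z + of_real (1 - \<alpha>) * (z * eval_fps (fps_deriv P) z)"
proof -
  have rad: "norm w < fps_conv_radius F" if "norm w < 1" for w :: complex
    using that by (auto intro: less_le_trans[OF _ F(1)])
  have f_eq: "f w = w * eval_fps P w" if "norm w < 1" for w
    using eval_fps_eq_mult_shift[OF rad F(2), of w] f that by (simp add: P_def)
  have "((\<lambda>w. w * eval_fps P w) has_field_derivative (eval_fps P z + z * eval_fps (fps_deriv P) z)) (at z)"
    using rad[OF z(1)] by (auto intro!: derivative_eq_intros has_field_derivative_eval_fps simp: P_def)
  then have "(f has_field_derivative (eval_fps P z + z * eval_fps (fps_deriv P) z)) (at z)"
    by (rule has_field_derivative_transform_within_open[of _ _ _ unit_disk]) (use z f_eq in auto)
  then have "deriv f z = eval_fps P z + z * eval_fps (fps_deriv P) z"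
    by (rule DERIV_imp_deriv)
  then show ?thesis
    using z f_eq[OF z(1)] by (simp add: algebra_simps)
qed

text \<open>The operator multiplies the \<open>n\<close>-th coefficient by a factor depending only
  on \<open>n\<close>. Such a factor can be moved onto either side of a Hadamard product.\<close>

lemma eval_fps_add_deriv:
  fixes P :: "complex fps" and c :: complex
  assumes "fps_conv_radius P \<ge> 1"
  defines "Q \<equiv> P + fps_const c * (fps_X * fps_deriv P)"
  shows "fps_conv_radius Q \<ge> 1"
    and "norm z < 1 \<Longrightarrow> eval_fps Q z = eval_fps P z + c * (z * eval_fps (fps_deriv P) z)"
    and "fps_nth Q n = (1 + c * of_nat n) * fps_nth P n"
proof -
  have D: "fps_conv_radius (fps_deriv P) \<ge> 1"
    using fps_conv_radius_deriv[of P] assms(1) by (rule order_trans[rotated])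
  have XD: "fps_conv_radius (fps_X * fps_deriv P) \<ge> 1"
    using D by (intro order_trans[OF _ fps_conv_radius_mult]) simp
  have cXD: "fps_conv_radius (fps_const c * (fps_X * fps_deriv P)) \<ge> 1"
    using XD by (intro order_trans[OF _ fps_conv_radius_mult]) simp
  show "fps_conv_radius Q \<ge> 1"
    unfolding Q_def using assms(1) cXD by (intro order_trans[OF _ fps_conv_radius_add]) simp
  show "fps_nth Q n = (1 + c * of_nat n) * fps_nth P n"
    by (cases n) (auto simp: Q_def fps_X_mult_nth algebra_simps)
  assume z: "norm z < 1"
  have rad: "norm z < fps_conv_radius A" if "fps_conv_radius A \<ge> 1" for A :: "complex fps"
    using z by (auto intro: less_le_trans[OF _ that])
  show "eval_fps Q z = eval_fps P z + c * (z * eval_fps (fps_deriv P) z)"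
    unfolding Q_def by (simp add: eval_fps_add eval_fps_mult rad assms(1) D XD cXD)
qed

theorem proposition4p19:
  fixes \<alpha> lam :: real and f g :: "complex \<Rightarrow> complex"
  assumes "\<alpha> \<le> 1" and "lam \<in> {0..1}"
    and "f \<in> class_G \<alpha> lam"
    and "g \<in> class_A"
    and "\<And>z. z \<in> unit_disk \<Longrightarrow> Re (quotient_id g z) > 1 / 2"
  shows "f \<in> class_G0 \<and> hadamard_product f g \<in> class_G \<alpha> lam"
proof -
  have fA: "f \<in> class_A"
    using assms(3) by (simp add: class_G_def)
  define F where "F = fps_expansion f 0"
  define G where "G = fps_expansion g 0"
  define P where "P = fps_shift 1 F"
  define Q where "Q = P + fps_const (of_real (1 - \<alpha>)) * (fps_X * fps_deriv P)"
  note F = class_A_fps[OF fA, folded F_def]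
  note G = class_A_fps[OF assms(4), folded G_def]
  have P: "fps_conv_radius P \<ge> 1"
    using F(1) by (simp add: P_def)
  note Q = eval_fps_add_deriv[OF P, where c = "of_real (1 - \<alpha>)", folded Q_def]
  have ReQ: "1 - lam \<le> Re (eval_fps Q z)" if z: "norm z < 1" for z
  proof (cases "z = 0")
    \<comment> \<open>The class condition says nothing at 0, but there \<open>Q\<close> has the
      value 1, and \<open>lam \<ge> 0\<close>.\<close>
    case True
    then show ?thesis
      using assms(2) F(3) Q(3)[of 0] by (simp add: eval_fps_at_0 P_def)
  next
    case False
    have "1 - lam \<le> Re (of_real \<alpha> * (f z / z) + (1 - of_real \<alpha>) * deriv f z)"
      using assms(3) z False by (simp add: class_G_def)
    also have "\<dots> = Re (eval_fps Q z)"
      by (simp only: class_G_expression_eq[OF F(4,1,2) z False, folded P_def] Q(2)[OF z])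
    finally show ?thesis .
  qed
  have rad: "norm z < fps_conv_radius P" if "norm z < 1" for z :: complex
    using that by (auto intro: less_le_trans[OF _ P])
  have ReP: "0 \<le> Re (eval_fps P z)" if "z \<in> unit_disk" for z
  proof (rule Re_ge_of_Re_add_deriv_ge[where R = 1 and \<beta> = "1 - \<alpha>"
        and p = "eval_fps P" and p' = "eval_fps (fps_deriv P)"])
    show "(eval_fps P has_field_derivative eval_fps (fps_deriv P) x) (at x)" if "x \<in> unit_disk" for x
      using that by (intro has_field_derivative_eval_fps rad) simp
    \<comment> \<open>Here \<open>lam \<le> 1\<close> makes the lower bound \<open>1 - lam\<close>
      nonnegative.\<close>
    show "0 \<le> Re (eval_fps P x + of_real (1 - \<alpha>) * (x * eval_fps (fps_deriv P) x))"
      if "x \<in> unit_disk" for x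
      using ReQ[of x] Q(2)[of x] that assms(2) by simp
  qed (use assms(1) that in auto)
  have "0 < Re (quotient_id f z)" if "z \<in> unit_disk" for z
  proof -
    have "0 < Re (eval_fps P z)"
    \<comment> \<open>The normalization of \<open>f\<close> gives \<open>P\<close> the value 1 at 0,
      which serves as the point of strict positivity.\<close>
    proof (rule Re_pos_of_Re_nonneg[where p = "eval_fps P" and S = unit_disk and a = 0])
      show "eval_fps P holomorphic_on unit_disk"
        using rad by (intro holomorphic_on_eval_fps) auto
      show "0 < Re (eval_fps P 0)"
        using F(3) by (simp add: eval_fps_at_0 P_def)
    qed (use that ReP in auto)
    then show ?thesis
      using that by (simp add: quotient_id_eq_eval_fps[OF fA] P_def F_def)
  qed
  then have "f \<in> class_G0"
    using fA by (simp add: class_G0_def)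

  define H where "H = Abs_fps (\<lambda>n. fps_nth F n * fps_nth G n)"
  have H_eq: "hadamard_product f g = eval_fps H"
    by (simp add: fun_eq_iff hadamard_product_def eval_fps_def H_def F_def G_def)
  have H: "fps_conv_radius H \<ge> 1" "fps_nth H 0 = 0" "fps_nth H (Suc 0) = 1"
    using fps_conv_radius_hadamard_ge_1[OF F(1) G(1)] F(2,3) G(3) by (simp_all add: H_def)
  define PH where "PH = fps_shift 1 H"
  have PH: "fps_conv_radius PH \<ge> 1"
    using H(1) by (simp add: PH_def)
  define QH where "QH = PH + fps_const (of_real (1 - \<alpha>)) * (fps_X * fps_deriv PH)"
  note QHs = eval_fps_add_deriv[OF PH, where c = "of_real (1 - \<alpha>)", folded QH_def]
  \<comment> \<open>The factor \<open>1 + (1 - \<alpha>) * n\<close> is absorbed into the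
    coefficients of \<open>f\<close>, so the expression for the Hadamard product is that for
    \<open>f\<close> convolved with \<open>g z / z\<close>, whose constant term is 1.\<close>
  have QH_eq: "QH = Abs_fps (\<lambda>n. fps_nth Q n * fps_nth (fps_shift 1 G) n)"
    by (rule fps_ext) (simp add: QHs(3) Q(3) PH_def P_def H_def)
  have "1 - lam \<le> Re (of_real \<alpha> * (eval_fps H z / z) + (1 - of_real \<alpha>) * deriv (eval_fps H) z)"
    if z: "norm z < 1" "z \<noteq> 0" for z
  proof -
    have "1 - lam \<le> Re (eval_fps QH z)"
      unfolding QH_eq
    proof (rule Re_hadamard_ge)
      show "1 / 2 < Re (eval_fps (fps_shift 1 G) x)" if "norm x < 1" for x
        using assms(5)[of x] that by (simp add: quotient_id_eq_eval_fps[OF assms(4)] G_def)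
    qed (use Q(1) G(1,3) ReQ z in auto)
    then show ?thesis
      using class_G_expression_eq[OF refl H(1,2) z, of \<alpha>, folded PH_def] QHs(2)[OF z(1)] by simp
  qed
  then have "hadamard_product f g \<in> class_G \<alpha> lam"
    using eval_fps_in_class_A[OF H] by (simp add: class_G_def H_eq)
  with \<open>f \<in> class_G0\<close> show ?thesis ..
qed

end
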